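(* Let $N$ and $d$ be two positive integers and assume that $d$ divides $N$. Then there exists $\mathcal T\subseteq\mathbb Z_N$ with $|\mathcal T|\le 3d\log_2(N/d)$ such that any nonnegative function on $\mathbb Z_N$ of degree at most $d$ has a sum-of-squares certificate supported on $\mathcal T$; that is, for every $f:\mathbb Z_N\to\mathbb R$ of degree at most $d$ with $f(x)\ge 0$ for all $x\in\mathbb Z_N$, there exist finitely many functions $f_1,\dots,f_J:\mathbb Z_N\to\mathbb C$, each supported on $\mathcal T$, with $f(x)=\sum_{j=1}^J|f_j(x)|^2$ for all $x\in\mathbb Z_N$.
   Context: $\mathbb Z_N$ is the additive group of integers modulo $N$. Every $f:\mathbb Z_N\to\mathbb C$ has a unique Fourier expansion $f(x)=\sum_{k\in\mathbb Z_N}\hat f(k)e^{2\pi i kx/N}$. The function $f$ is supported on $\mathcal A\subseteq\mathbb Z_N$ if $\hat f(k)=0$ for all $k\notin\mathcal A$. The function $f$ has degree at most $d$ if it is supported on $\{-d,-(d-1),\dots,d-1,d\}$ (taken mod $N$). The set $\mathcal T$ does not depend on $f$.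
   Formalization: The formal theorem additionally assumes d < N; for d = N the bound 3d log2(N/d) is 0, so T would be empty and the constant function 1 has no certificate, hence the statement is false in that case. *)

theory Defs
  imports "HOL-Analysis.Analysis" "HOL-Number_Theory.Residues"
begin

text \<open>
  The group of integers modulo N is represented by the canonical residues, the carrier
  of \<^const>\<open>residue_ring\<close>.  A function on it is a function on \<^typ>\<open>int\<close> of which only the values
  on the canonical residues matter.
\<close>

abbreviation ZN :: "nat \<Rightarrow> int set" where
  "ZN N \<equiv> carrier (residue_ring (int N))"

definition character :: "nat \<Rightarrow> int \<Rightarrow> int \<Rightarrow> complex" where
  "character N k x = exp (2 * of_real pi * \<i> * of_int k * of_int x / of_nat N)"

definition fourier_expansion :: "nat \<Rightarrow> (int \<Rightarrow> complex) \<Rightarrow> (int \<Rightarrow> complex) \<Rightarrow> bool" where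
  "fourier_expansion N f c \<longleftrightarrow> (\<forall>x\<in>ZN N. f x = (\<Sum>k\<in>ZN N. c k * character N k x))"

text \<open>Extensionality only pins down the irrelevant values of the coefficient function
  off the canonical residues.\<close>

definition fourier_coeff :: "nat \<Rightarrow> (int \<Rightarrow> complex) \<Rightarrow> int \<Rightarrow> complex" where
  "fourier_coeff N f = (THE c. c \<in> extensional (ZN N) \<and> fourier_expansion N f c)"

definition supported_on :: "nat \<Rightarrow> int set \<Rightarrow> (int \<Rightarrow> complex) \<Rightarrow> bool" where
  "supported_on N A f \<longleftrightarrow> (\<forall>k\<in>ZN N - A. fourier_coeff N f k = 0)"

definition degree_at_most :: "nat \<Rightarrow> nat \<Rightarrow> (int \<Rightarrow> complex) \<Rightarrow> bool" where
  "degree_at_most N d f \<longleftrightarrow> supported_on N ((\<lambda>k. k mod int N) ` {- int d..int d}) f"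

definition has_sos_certificate :: "nat \<Rightarrow> int set \<Rightarrow> (int \<Rightarrow> real) \<Rightarrow> bool" where
  "has_sos_certificate N T f \<longleftrightarrow>
     (\<exists>(J::nat) (g :: nat \<Rightarrow> int \<Rightarrow> complex).
        (\<forall>j<J. supported_on N T (g j)) \<and>
        (\<forall>x\<in>ZN N. f x = (\<Sum>j<J. (cmod (g j x))\<^sup>2)))"

lemma ZN_eq: "ZN N = {0..<int N}"
  by (auto simp: residue_ring_def)

lemma sum_ZN: "(\<Sum>x\<in>ZN N. h x) = (\<Sum>i<N. h (int i))"
  unfolding ZN_eq
  by (rule sum.reindex_bij_witness[where i = int and j = nat]) auto

lemma character_commute: "character N k x = character N x k"
  by (simp add: character_def mult_ac)

lemma character_uminus: "character N (- k) x = character N (- x) k"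
  by (simp add: character_def mult_ac)

lemma character_mult: "character N a x * character N b x = character N (a + b) x"
  by (simp add: character_def exp_add[symmetric] add_divide_distrib ring_distribs)

lemma character_orthogonal:
  assumes "N > 0"
  shows "(\<Sum>x\<in>ZN N. character N m x) = (if int N dvd m then of_nat N else 0)"
proof -
  define w where "w = character N m 1"
  have w: "character N m (int i) = w ^ i" for i
    by (simp add: w_def character_def exp_of_nat_mult[symmetric] mult_ac)
  have sum: "(\<Sum>x\<in>ZN N. character N m x) = (\<Sum>i<N. w ^ i)"
    by (simp add: sum_ZN w)
  have wN: "w ^ N = 1"
  proof -
    have "w ^ N = exp (2 * of_real pi * \<i> * of_int m)"
      using assms by (simp add: w_def character_def exp_of_nat_mult[symmetric])
    also have "\<dots> = 1"
      by (subst exp_eq_1) auto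
    finally show ?thesis .
  qed
  have "w = 1 \<longleftrightarrow> int N dvd m"
  proof -
    have "w = 1 \<longleftrightarrow> (\<exists>n::int. 2 * pi * of_int m / of_nat N = of_int (2 * n) * pi)"
      by (simp add: w_def character_def exp_eq_1 Re_divide_of_nat Im_divide_of_nat)
    also have "\<dots> \<longleftrightarrow> (\<exists>n::int. real_of_int m = of_int (int N * n))"
      using assms by (simp add: field_simps)
    also have "\<dots> \<longleftrightarrow> int N dvd m"
      unfolding of_int_eq_iff dvd_def by blast
    finally show ?thesis .
  qed
  then show ?thesis
    using wN by (auto simp: sum geometric_sum)
qed

lemma fourier_expansion_imp_coeff:
  assumes "N > 0" "fourier_expansion N f c" "k \<in> ZN N"
  shows "c k = (\<Sum>x\<in>ZN N. f x * character N (- k) x) / of_nat N"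
proof -
  have "(\<Sum>x\<in>ZN N. f x * character N (- k) x)
      = (\<Sum>x\<in>ZN N. \<Sum>l\<in>ZN N. c l * character N (l - k) x)"
    using assms(2)
    by (intro sum.cong refl)
       (simp add: fourier_expansion_def sum_distrib_right mult.assoc character_mult)
  also have "\<dots> = (\<Sum>l\<in>ZN N. c l * (\<Sum>x\<in>ZN N. character N (l - k) x))"
    by (subst sum.swap) (simp add: sum_distrib_left)
  also have "\<dots> = (\<Sum>l\<in>ZN N. if l = k then c l * of_nat N else 0)"
  proof (intro sum.cong refl)
    fix l assume "l \<in> ZN N"
    with assms(3) have "int N dvd l - k \<longleftrightarrow> l = k"
      unfolding ZN_eq by (auto simp flip: mod_eq_dvd_iff)
    then show "c l * (\<Sum>x\<in>ZN N. character N (l - k) x) = (if l = k then c l * of_nat N else 0)"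
      by (simp add: character_orthogonal[OF assms(1)])
  qed
  also have "\<dots> = c k * of_nat N"
    using assms(3) by (simp add: ZN_eq)
  finally show ?thesis
    using assms(1) by simp
qed

lemma fourier_expansion_exists:
  assumes "N > 0"
  shows "fourier_expansion N f (\<lambda>k. (\<Sum>x\<in>ZN N. f x * character N (- k) x) / of_nat N)"
  unfolding fourier_expansion_def
proof
  fix y assume y: "y \<in> ZN N"
  have "(\<Sum>k\<in>ZN N. (\<Sum>x\<in>ZN N. f x * character N (- k) x) / of_nat N * character N k y)
      = (\<Sum>k\<in>ZN N. \<Sum>x\<in>ZN N. f x / of_nat N * character N (y - x) k)"
  proof (intro sum.cong refl)
    fix k
    have "f x * character N (- k) x / of_nat N * character N k y
        = f x / of_nat N * character N (y - x) k" for x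
      using character_mult[of N "- x" k y]
      by (simp add: character_uminus[of N k] character_commute[of N k y] mult.assoc)
    then show "(\<Sum>x\<in>ZN N. f x * character N (- k) x) / of_nat N * character N k y
        = (\<Sum>x\<in>ZN N. f x / of_nat N * character N (y - x) k)"
      by (simp only: sum_divide_distrib sum_distrib_right)
  qed
  also have "\<dots> = (\<Sum>x\<in>ZN N. f x / of_nat N * (\<Sum>k\<in>ZN N. character N (y - x) k))"
    by (subst sum.swap) (simp add: sum_distrib_left)
  also have "\<dots> = (\<Sum>x\<in>ZN N. if x = y then f x else 0)"
  proof (intro sum.cong refl)
    fix x assume "x \<in> ZN N"
    with y have "int N dvd y - x \<longleftrightarrow> x = y"
      unfolding ZN_eq by (auto simp flip: mod_eq_dvd_iff)
    then show "f x / of_nat N * (\<Sum>k\<in>ZN N. character N (y - x) k) = (if x = y then f x else 0)"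
      using assms by (simp add: character_orthogonal)
  qed
  also have "\<dots> = f y"
    using y by (simp add: ZN_eq)
  finally show "f y = (\<Sum>k\<in>ZN N. (\<Sum>x\<in>ZN N. f x * character N (- k) x) / of_nat N * character N k y)"
    by (rule sym)
qed

lemma fourier_coeff_unique:
  assumes "N > 0"
  shows "\<exists>!c. c \<in> extensional (ZN N) \<and> fourier_expansion N f c"
proof -
  define c where "c = restrict (\<lambda>k. (\<Sum>x\<in>ZN N. f x * character N (- k) x) / of_nat N) (ZN N)"
  show ?thesis
  proof (rule ex1I[of _ c])
    have "fourier_expansion N f c
        \<longleftrightarrow> fourier_expansion N f (\<lambda>k. (\<Sum>x\<in>ZN N. f x * character N (- k) x) / of_nat N)"
      by (simp add: c_def fourier_expansion_def cong: sum.cong)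
    then show "c \<in> extensional (ZN N) \<and> fourier_expansion N f c"
      using fourier_expansion_exists[OF assms, of f] by (simp add: c_def)
  next
    fix b assume "b \<in> extensional (ZN N) \<and> fourier_expansion N f b"
    then show "b = c"
      using fourier_expansion_imp_coeff[OF assms, of f b]
      by (intro extensionalityI[of _ "ZN N"]) (auto simp: c_def)
  qed
qed

lemma fourier_expansion_coeff:
  assumes "N > 0"
  shows "fourier_expansion N f (fourier_coeff N f)"
  using theI'[OF fourier_coeff_unique[OF assms]] unfolding fourier_coeff_def by blast

lemma fourier_coeff_eq:
  assumes "N > 0" "k \<in> ZN N"
  shows "fourier_coeff N f k = (\<Sum>x\<in>ZN N. f x * character N (- k) x) / of_nat N"
  by (rule fourier_expansion_imp_coeff[OF assms(1) fourier_expansion_coeff[OF assms(1)] assms(2)])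

text \<open>
  The bound 3 * d * log 2 (N / d) vanishes when d = N, and no set of that size works: the
  constant function 1 has no certificate supported on the empty set.
\<close>

lemma no_certificate_if_degree_eq_modulus:
  assumes "N > 0"
  shows "\<not> (\<exists>T\<subseteq>ZN N. real (card T) \<le> 3 * real N * log 2 (real N / real N) \<and>
            (\<forall>f. degree_at_most N N (\<lambda>x. complex_of_real (f x)) \<and> (\<forall>x\<in>ZN N. f x \<ge> 0) \<longrightarrow>
                 has_sos_certificate N T f))"
proof
  assume "\<exists>T\<subseteq>ZN N. real (card T) \<le> 3 * real N * log 2 (real N / real N) \<and>
            (\<forall>f. degree_at_most N N (\<lambda>x. complex_of_real (f x)) \<and> (\<forall>x\<in>ZN N. f x \<ge> 0) \<longrightarrow>
                 has_sos_certificate N T f)"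
  then obtain T where T: "T \<subseteq> ZN N" "real (card T) \<le> 3 * real N * log 2 (real N / real N)"
    and sos: "\<And>f. degree_at_most N N (\<lambda>x. complex_of_real (f x)) \<Longrightarrow> (\<forall>x\<in>ZN N. f x \<ge> 0) \<Longrightarrow>
                 has_sos_certificate N T f"
    by blast
  have "finite T"
    using T(1) by (rule finite_subset) (simp add: ZN_eq)
  with T(2) assms have "T = {}"
    by simp
  have "k \<in> (\<lambda>k. k mod int N) ` {- int N..int N}" if "k \<in> ZN N" for k
    using that unfolding ZN_eq by (intro image_eqI[of _ _ k]) auto
  then have "degree_at_most N N (\<lambda>x. complex_of_real ((\<lambda>_. 1) x))"
    unfolding degree_at_most_def supported_on_def by blast
  from sos[OF this] obtain J :: nat and g where
    g: "\<And>j. j < J \<Longrightarrow> supported_on N {} (g j)"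
       "\<And>x. x \<in> ZN N \<Longrightarrow> 1 = (\<Sum>j<J. (cmod (g j x))\<^sup>2)"
    unfolding has_sos_certificate_def \<open>T = {}\<close> by auto
  have zero: "0 \<in> ZN N"
    using assms by (simp add: ZN_eq)
  have "g j 0 = 0" if "j < J" for j
    using fourier_expansion_coeff[OF assms, of "g j"] g(1)[OF that] zero
    by (simp add: fourier_expansion_def supported_on_def)
  then show False
    using g(2)[OF zero] by simp
qed

end

theory Submission
  imports Defs
begin

text \<open>
  A nonnegative \<open>f\<close> is the symbol of the positive semidefinite circulant matrix with entries
  \<open>f^(k - l)\<close>, and evaluating its Hermitian form at the vector of characters returns \<open>N f(x)\<close>.
  Eliminating the indices one by one (Cholesky factorisation) writes the form as a sum of squares; if the
  order is a perfect elimination order of a chordal graph containing the nonzero pattern, the square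
  split off at \<open>v\<close> involves only \<open>v\<close> and its later neighbours.  Multiplying a square by a character
  translates its support without changing its modulus, so it suffices that these neighbourhoods can
  all be translated into \<open>T\<close>.

  For degree \<open>d\<close> and \<open>N = d m\<close> the pattern is contained in the blow-up of the \<open>m\<close>-cycle by blocks of
  size \<open>d\<close>.  The cycle is triangulated dyadically: nodes are eliminated in order of increasing
  2-adic valuation \<open>v\<close>, the later neighbours of \<open>i\<close> being \<open>i - 2^v\<close> and \<open>i + 2^v\<close>, the latter replaced
  by \<open>0\<close> when it passes \<open>m\<close>.  Each valuation contributes one triangle up to translation, plus at most
  one wrapped triangle.
\<close>

subsection \<open>Hermitian forms and chordal elimination\<close>

definition hermitian_form :: "'a set \<Rightarrow> ('a \<Rightarrow> 'a \<Rightarrow> complex) \<Rightarrow> ('a \<Rightarrow> complex) \<Rightarrow> complex" where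
  "hermitian_form V M z = (\<Sum>k\<in>V. \<Sum>l\<in>V. M k l * z k * cnj (z l))"

lemma hermitian_form_remove:
  assumes "finite V" "v \<in> V"
    and "\<And>k. k \<in> V \<Longrightarrow> M k v = 0" "\<And>l. l \<in> V \<Longrightarrow> M v l = 0"
  shows "hermitian_form V M z = hermitian_form (V - {v}) M z"
  using assms by (simp add: hermitian_form_def sum.remove[of V v])

lemma hermitian_form_rank_one:
  "hermitian_form V (\<lambda>k l. a k * cnj (a l)) z = of_real ((cmod (\<Sum>k\<in>V. a k * z k))\<^sup>2)"
  by (simp only: complex_norm_square hermitian_form_def cnj_sum complex_cnj_mult sum_product)
     (intro sum.cong refl, simp)

lemma hermitian_form_add:
  "hermitian_form V (\<lambda>k l. A k l + B k l) z = hermitian_form V A z + hermitian_form V B z"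
  by (simp add: hermitian_form_def ring_distribs sum.distrib)

lemma hermitian_form_cong:
  assumes "\<And>k l. k \<in> V \<Longrightarrow> l \<in> V \<Longrightarrow> A k l = B k l" "\<And>k. k \<in> V \<Longrightarrow> y k = z k"
  shows "hermitian_form V A y = hermitian_form V B z"
  unfolding hermitian_form_def using assms by (intro sum.cong refl) simp

lemma hermitian_form_mono_neutral:
  assumes "finite V" "U \<subseteq> V" "\<And>k. k \<in> V - U \<Longrightarrow> z k = 0"
  shows "hermitian_form V M z = hermitian_form U M z"
proof -
  have "(\<Sum>l\<in>V. M k l * z k * cnj (z l)) = (\<Sum>l\<in>U. M k l * z k * cnj (z l))" for k
    using assms by (intro sum.mono_neutral_right) auto
  then show ?thesis
    unfolding hermitian_form_def using assms by (auto intro!: sum.mono_neutral_right)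
qed

text \<open>With the coordinate at \<open>k\<close> fixed, the form is real-affine in the coordinate
  at \<open>v\<close> because \<open>M v v = 0\<close>, so a nonzero \<open>M k v\<close> would make
  it unbounded below.\<close>

lemma psd_diagonal_zero:
  assumes "finite V" "v \<in> V" "k \<in> V"
    and herm: "\<And>k l. k \<in> V \<Longrightarrow> l \<in> V \<Longrightarrow> M l k = cnj (M k l)"
    and psd: "\<And>z. 0 \<le> Re (hermitian_form V M z)"
    and "M v v = 0"
  shows "M k v = 0"
proof (rule ccontr)
  assume nz: "M k v \<noteq> 0"
  with \<open>M v v = 0\<close> have "k \<noteq> v" by auto
  \<comment> \<open>With c = \<open>Re (M k k)\<close>, the real part of the form at
    \<open>z\<close> is \<open>c - 2 t |M k v|^2\<close>; this \<open>t\<close> makes it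
    \<open>c - 2 (1 + |c|)\<close>, which is negative.\<close>
  define t :: real where "t = (1 + \<bar>Re (M k k)\<bar>) / (cmod (M k v))\<^sup>2"
  define z where "z = (\<lambda>x. if x = k then 1 else if x = v then - of_real t * M k v else 0)"
  have "hermitian_form V M z = hermitian_form {k, v} M z"
    using assms(1-3) by (intro hermitian_form_mono_neutral) (auto simp: z_def)
  also have "\<dots> = M k k - 2 * of_real t * (M k v * cnj (M k v))"
    using \<open>k \<noteq> v\<close> \<open>M v v = 0\<close> herm[of k v] assms(2,3)
    by (simp add: hermitian_form_def z_def algebra_simps)
  also have "\<dots> = M k k - 2 * of_real (t * (cmod (M k v))\<^sup>2)"
    by (simp only: complex_norm_square[symmetric] of_real_mult mult.assoc)
  also have "t * (cmod (M k v))\<^sup>2 = 1 + \<bar>Re (M k k)\<bar>"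
    using nz by (simp add: t_def)
  finally have "Re (hermitian_form V M z) = Re (M k k) - 2 * (1 + \<bar>Re (M k k)\<bar>)"
    by simp
  moreover have "c - 2 * (1 + \<bar>c\<bar>) < 0" for c :: real
    by (cases "c \<ge> 0") auto
  ultimately show False
    using psd[of z] by (metis not_le)
qed

text \<open>Subtract a rank-one matrix that clears the row and column of a vertex of least rank, and
  induct on the Schur complement. Ties in \<open>r\<close> are allowed, as any vertex of least rank
  can go first; in the blow-up a whole block shares one rank.\<close>

lemma chordal_sos_decomposition:
  fixes r :: "'a \<Rightarrow> nat"
  assumes "finite V"
    and "\<And>k l. k \<in> V \<Longrightarrow> l \<in> V \<Longrightarrow> M l k = cnj (M k l)"
    and "\<And>z. 0 \<le> Re (hermitian_form V M z)"
    and "\<And>k l. k \<in> V \<Longrightarrow> l \<in> V \<Longrightarrow> M k l \<noteq> 0 \<Longrightarrow> adj k l"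
    and "\<And>v k l. v \<in> V \<Longrightarrow> k \<in> V \<Longrightarrow> l \<in> V \<Longrightarrow> r v \<le> r k \<Longrightarrow> r v \<le> r l \<Longrightarrow>
           adj v k \<Longrightarrow> adj v l \<Longrightarrow> adj k l"
  shows "\<exists>g. (\<forall>v\<in>V. \<forall>k\<in>V. g v k \<noteq> 0 \<longrightarrow> adj v k \<and> r v \<le> r k) \<and>
             (\<forall>z. hermitian_form V M z = of_real (\<Sum>v\<in>V. (cmod (\<Sum>k\<in>V. g v k * z k))\<^sup>2))"
  using assms
proof (induction V arbitrary: M rule: finite_psubset_induct)
  case (psubset V)
  note herm = psubset.prems(1) and psd = psubset.prems(2) and supp = psubset.prems(3)
    and chordal = psubset.prems(4)
  show ?case
  proof (cases "V = {}")
    case True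
    then show ?thesis by (simp add: hermitian_form_def)
  next
    case False
    define v where "v = arg_min_on r V"
    have v: "v \<in> V" and least: "\<And>k. k \<in> V \<Longrightarrow> r v \<le> r k"
      using arg_min_if_finite[OF psubset.hyps False, of r] unfolding v_def by force+
    define p where "p = Re (M v v)"
    have Mvv: "M v v = of_real p"
      using herm[OF v v] by (simp add: p_def complex_eq_iff)
    have "hermitian_form V M (\<lambda>x. if x = v then 1 else 0) = hermitian_form {v} M (\<lambda>x. if x = v then 1 else 0)"
      using psubset.hyps v by (intro hermitian_form_mono_neutral) auto
    then have "p \<ge> 0"
      using psd[of "\<lambda>x. if x = v then 1 else 0"] by (simp add: hermitian_form_def p_def)
    have col: "M k v = 0" if "p = 0" "k \<in> V" for k
      using psd_diagonal_zero[OF psubset.hyps v that(2) herm psd] Mvv that(1) by simp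
    \<comment> \<open>If \<open>p = 0\<close>, division by zero makes \<open>a\<close> zero; column
      \<open>v\<close> then vanishes already by \<open>col\<close>, so row and column
      \<open>v\<close> of \<open>M'\<close> are zero in both cases.\<close>
    define a where "a k = M k v / of_real (sqrt p)" for k
    define M' where "M' k l = M k l - a k * cnj (a l)" for k l
    have acnj: "a k * cnj (a l) = M k v * M v l / of_real p" if "l \<in> V" for k l
      using \<open>p \<ge> 0\<close> herm[OF that v] by (simp add: a_def flip: of_real_mult)
    have M'v: "M' k v = 0" "M' v k = 0" if "k \<in> V" for k
      using that v herm[OF that v] col[OF _ that]
      by (cases "p = 0"; simp add: M'_def acnj Mvv)+
    define L where "L z = (\<Sum>k\<in>V. a k * z k)" for z
    have split: "hermitian_form V M z = of_real ((cmod (L z))\<^sup>2) + hermitian_form (V - {v}) M' z" for z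
    proof -
      have "hermitian_form V M z = hermitian_form V (\<lambda>k l. a k * cnj (a l) + M' k l) z"
        by (intro hermitian_form_cong) (auto simp: M'_def)
      then show ?thesis
        using hermitian_form_remove[OF psubset.hyps v, of M' z] M'v
        by (simp add: hermitian_form_add hermitian_form_rank_one L_def)
    qed
    have "\<exists>g. (\<forall>w\<in>V - {v}. \<forall>k\<in>V - {v}. g w k \<noteq> 0 \<longrightarrow> adj w k \<and> r w \<le> r k) \<and>
             (\<forall>z. hermitian_form (V - {v}) M' z
                = of_real (\<Sum>w\<in>V - {v}. (cmod (\<Sum>k\<in>V - {v}. g w k * z k))\<^sup>2))"
    proof (rule psubset.IH)
      show "V - {v} \<subset> V" using v by auto
      show "M' l k = cnj (M' k l)" if "k \<in> V - {v}" "l \<in> V - {v}" for k l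
        using that herm[of k l] by (simp add: M'_def mult.commute)
      \<comment> \<open>Fill-in: an entry that is zero in \<open>M\<close> but not in
        \<open>M'\<close> joins two neighbours of \<open>v\<close>, which are adjacent by
        chordality.\<close>
      show "adj k l" if "k \<in> V - {v}" "l \<in> V - {v}" "M' k l \<noteq> 0" for k l
      proof (cases "M k l = 0")
        case True
        then have "M k v \<noteq> 0" "M v l \<noteq> 0"
          using that acnj[of l k] by (auto simp: M'_def)
        then show ?thesis
          using that v herm[of k v] least
          by (intro chordal[of v k l] supp) auto
      qed (use that supp in auto)
      show "0 \<le> Re (hermitian_form (V - {v}) M' z)" for z
      proof -
        txt \<open>The value at \<open>v\<close> is chosen to annihilate the split-off square.\<close>
        define y where "y = z(v := - (\<Sum>k\<in>V - {v}. a k * z k) / a v)"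
        have "L y = a v * y v + (\<Sum>k\<in>V - {v}. a k * z k)"
          using psubset.hyps v by (simp add: L_def sum.remove[of V v] y_def)
        moreover have "a v \<noteq> 0" if "p \<noteq> 0"
          using that Mvv by (simp add: a_def)
        moreover have "a k = 0" if "p = 0" for k
          using that by (simp add: a_def)
        ultimately have "L y = 0"
          by (cases "p = 0") (auto simp: y_def)
        moreover have "hermitian_form (V - {v}) M' y = hermitian_form (V - {v}) M' z"
          by (rule hermitian_form_cong) (auto simp: y_def)
        ultimately have "hermitian_form V M y = hermitian_form (V - {v}) M' z"
          unfolding split by simp
        with psd[of y] show ?thesis by simp
      qed
    qed (use chordal in auto)
    then obtain g where g: "\<And>w k. w \<in> V - {v} \<Longrightarrow> k \<in> V - {v} \<Longrightarrow> g w k \<noteq> 0 \<Longrightarrow> adj w k \<and> r w \<le> r k"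
      and gsum: "\<And>z. hermitian_form (V - {v}) M' z
                = of_real (\<Sum>w\<in>V - {v}. (cmod (\<Sum>k\<in>V - {v}. g w k * z k))\<^sup>2)"
      by blast
    \<comment> \<open>Row \<open>v\<close> holds the split-off square; zeros in column
      \<open>v\<close> leave the other squares unchanged.\<close>
    define h where "h w k = (if w = v then a k else if k = v then 0 else g w k)" for w k
    have "adj w k \<and> r w \<le> r k" if "w \<in> V" "k \<in> V" "h w k \<noteq> 0" for w k
    proof (cases "w = v")
      case True
      then have "M k v \<noteq> 0" using that by (auto simp: h_def a_def)
      then have "M v k \<noteq> 0" using herm[of k v] that v by simp
      then show ?thesis using True that supp v least by auto
    qed (use that g[of w k] in \<open>auto simp: h_def split: if_splits\<close>)
    moreover have "hermitian_form V M z = of_real (\<Sum>w\<in>V. (cmod (\<Sum>k\<in>V. h w k * z k))\<^sup>2)" for z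
    proof -
      have "(\<Sum>k\<in>V. h w k * z k) = (\<Sum>k\<in>V - {v}. g w k * z k)" if "w \<in> V - {v}" for w
        using that psubset.hyps v by (simp add: sum.remove[of V v] h_def)
      moreover have "(\<Sum>k\<in>V. h v k * z k) = L z"
        by (simp add: h_def L_def)
      ultimately show ?thesis
        using psubset.hyps v by (simp add: split gsum sum.remove[of V v "\<lambda>w. (cmod (\<Sum>k\<in>V. h w k * z k))\<^sup>2"])
    qed
    ultimately show ?thesis by blast
  qed
qed

subsection \<open>Dyadic triangulation of a cycle\<close>

text \<open>Truncated subtraction gives \<open>prev_node 0 = 0\<close>, so the clique of node 0 is
  translated by 0.\<close>

definition prev_node :: "nat \<Rightarrow> nat" where
  "prev_node i = i - 2 ^ multiplicity 2 i"

definition next_node :: "nat \<Rightarrow> nat \<Rightarrow> nat" where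
  "next_node m i = (if i + 2 ^ multiplicity 2 i < m then i + 2 ^ multiplicity 2 i else 0)"

definition dyadic_clique :: "nat \<Rightarrow> nat \<Rightarrow> nat set" where
  "dyadic_clique m i = (if i = 0 then {0} else {i, prev_node i, next_node m i})"

text \<open>Node \<open>0\<close> is eliminated last: \<open>m\<close> exceeds the valuation of every positive node below \<open>m\<close>.\<close>

definition dyadic_level :: "nat \<Rightarrow> nat \<Rightarrow> nat" where
  "dyadic_level m i = (if i = 0 then m else multiplicity 2 i)"

definition dyadic_adj :: "nat \<Rightarrow> nat \<Rightarrow> nat \<Rightarrow> bool" where
  "dyadic_adj m i j \<longleftrightarrow> j \<in> dyadic_clique m i \<or> i \<in> dyadic_clique m j"

section \<open>2-adic valuations and the elimination order of the cycle\<close>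

lemma two_adic_decomposition:
  fixes i :: nat
  assumes "i > 0"
  obtains u where "i = 2 ^ multiplicity 2 i * (2 * u + 1)"
proof -
  obtain y where y: "i = 2 ^ multiplicity 2 i * y" "\<not> 2 dvd y"
    using multiplicity_decompose'[of i 2] assms by auto
  from y(2) obtain u where "y = 2 * u + 1" by (elim oddE)
  with y(1) that show thesis by blast
qed

lemma multiplicity_two_odd:
  "multiplicity 2 (2 ^ v * (2 * u + 1) :: nat) = v"
proof (rule multiplicity_eqI)
  show "\<not> 2 ^ Suc v dvd 2 ^ v * (2 * u + 1)"
    unfolding power_Suc2 nat_mult_dvd_cancel_disj by simp
qed simp

lemma power_multiplicity_two_le: "i > 0 \<Longrightarrow> 2 ^ multiplicity 2 i \<le> (i::nat)"
  by (simp add: dvd_imp_le multiplicity_dvd)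

lemma multiplicity_two_less:
  "0 < i \<Longrightarrow> i < m \<Longrightarrow> multiplicity 2 i < (m::nat)"
  using power_multiplicity_two_le[of i] less_exp[of "multiplicity 2 i"] by linarith

lemma multiplicity_two_gt:
  fixes u :: nat
  assumes "u > 0"
  shows "v < multiplicity 2 (2 ^ v * (2 * u))"
proof -
  have "Suc v \<le> multiplicity 2 (2 ^ v * (2 * u))"
    using assms by (intro multiplicity_geI) auto
  then show ?thesis by simp
qed

text \<open>For \<open>i = 2^v (2u + 1)\<close> the other nodes are even multiples of
  \<open>2^v\<close>: each is 0, of level \<open>m > v\<close>, or has valuation above
  \<open>v\<close>.\<close>

lemma dyadic_clique_level:
  assumes "i < m" "j \<in> dyadic_clique m i" "j \<noteq> i"
  shows "dyadic_level m i < dyadic_level m j"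
proof -
  from assms have "i > 0" by (auto simp: dyadic_clique_def split: if_splits)
  define v where "v = multiplicity 2 i"
  obtain u where u: "i = 2 ^ v * (2 * u + 1)"
    using two_adic_decomposition[OF \<open>i > 0\<close>] unfolding v_def by blast
  have lev: "dyadic_level m i = v" and "v < m"
    using \<open>i > 0\<close> multiplicity_two_less[OF _ assms(1)] by (auto simp: dyadic_level_def v_def)
  have "j = 0 \<or> (\<exists>w>0. j = 2 ^ v * (2 * w))"
  proof -
    have "prev_node i = 2 ^ v * (2 * u)"
      unfolding prev_node_def v_def[symmetric] by (subst u) simp
    moreover have "next_node m i = 0 \<or> next_node m i = 2 ^ v * (2 * (u + 1))"
      unfolding next_node_def v_def[symmetric] by (subst (2) u) (simp add: u algebra_simps)
    ultimately show ?thesis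
      using assms \<open>i > 0\<close> by (cases "u = 0") (auto simp: dyadic_clique_def)
  qed
  then show ?thesis
    using \<open>v < m\<close> multiplicity_two_gt[of _ v] unfolding lev by (auto simp: dyadic_level_def)
qed

text \<open>If instead \<open>i\<close> lay in the clique of some \<open>j\<close> other than
  \<open>i\<close>, the level of \<open>i\<close> would exceed that of \<open>j\<close>.\<close>

lemma dyadic_adj_level:
  assumes "i < m" "j < m" "dyadic_adj m i j" "dyadic_level m i \<le> dyadic_level m j"
  shows "j \<in> dyadic_clique m i"
  using assms dyadic_clique_level[of j m i] by (fastforce simp: dyadic_adj_def dyadic_clique_def)

lemma dyadic_adj_sym: "dyadic_adj m i j \<Longrightarrow> dyadic_adj m j i"
  by (auto simp: dyadic_adj_def)

lemma dyadic_adj_refl: "dyadic_adj m i i"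
  by (auto simp: dyadic_adj_def dyadic_clique_def)

text \<open>Without wrapping, the two nodes are \<open>2^(v + 1)\<close> times \<open>u\<close> and
  \<open>u + 1\<close>; the one with the odd factor has valuation exactly \<open>v + 1\<close>, and
  the other is its neighbour.\<close>

lemma dyadic_adj_prev_next:
  assumes "0 < i" "i < m"
  shows "dyadic_adj m (prev_node i) (next_node m i)"
proof -
  define v where "v = multiplicity 2 i"
  obtain u where u: "i = 2 ^ v * (2 * u + 1)"
    using two_adic_decomposition[OF \<open>i > 0\<close>] unfolding v_def by blast
  have prev: "prev_node i = 2 ^ Suc v * u"
    unfolding prev_node_def v_def[symmetric] by (subst u) simp
  show ?thesis
  proof (cases "i + 2 ^ v < m")
    case True
    then have nxt: "next_node m i = 2 ^ Suc v * (u + 1)"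
      unfolding next_node_def v_def[symmetric] by (simp add: u algebra_simps)
    have lt: "2 ^ Suc v * (u + 1) < m"
      using True by (simp add: u algebra_simps)
    show ?thesis
    proof (cases "even u")
      case True
      then obtain w where "u = 2 * w" by (elim evenE)
      then have "multiplicity 2 (next_node m i) = Suc v"
        using multiplicity_two_odd[of "Suc v" w] by (simp add: nxt)
      then have "prev_node (next_node m i) = prev_node i"
        unfolding prev_node_def[of "next_node m i"] by (simp add: nxt prev algebra_simps)
      moreover have "next_node m i \<noteq> 0" by (simp add: nxt)
      ultimately show ?thesis by (simp add: dyadic_adj_def dyadic_clique_def)
    next
      case False
      then obtain w where w: "u = 2 * w + 1" by (elim oddE)
      then have "multiplicity 2 (prev_node i) = Suc v"
        using multiplicity_two_odd[of "Suc v" w] by (simp add: prev)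
      then have "next_node m (prev_node i) = next_node m i"
        unfolding next_node_def[of m "prev_node i"] using lt by (simp add: nxt prev algebra_simps)
      moreover have "prev_node i \<noteq> 0" using w by (simp add: prev)
      ultimately show ?thesis by (simp add: dyadic_adj_def dyadic_clique_def)
    qed
  next
    case False
    then have nxt: "next_node m i = 0"
      by (simp add: next_node_def v_def)
    show ?thesis
    proof (cases "u = 0")
      case True
      then show ?thesis by (simp add: prev nxt dyadic_adj_refl)
    next
      case u0: False
      \<comment> \<open>The step of \<open>prev_node i\<close> is at least \<open>2^(v + 1)\<close>,
        and \<open>prev_node i + 2^(v + 1) = i + 2^v\<close> has already reached \<open>m\<close>,
        so its next node wraps to 0 as well.\<close>
      have "Suc v \<le> multiplicity 2 (prev_node i)"
        using multiplicity_two_gt[of u v] u0 by (simp add: prev mult_ac)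
      then have "(2::nat) ^ Suc v \<le> 2 ^ multiplicity 2 (prev_node i)"
        by (rule power_increasing) simp
      moreover have "prev_node i + 2 ^ Suc v = i + 2 ^ v"
        unfolding prev using u by (simp add: algebra_simps)
      ultimately have "next_node m (prev_node i) = 0"
        using False by (simp add: next_node_def)
      then show ?thesis using u0 by (simp add: nxt dyadic_adj_def dyadic_clique_def prev)
    qed
  qed
qed

text \<open>Combined with \<open>dyadic_adj_level\<close>, this makes increasing level a perfect
  elimination order.\<close>

lemma dyadic_clique_adj:
  assumes "i < m" "x \<in> dyadic_clique m i" "y \<in> dyadic_clique m i"
  shows "dyadic_adj m x y"
proof (cases "i = 0")
  case True
  with assms show ?thesis by (simp add: dyadic_clique_def dyadic_adj_refl)
next
  case False
  then have "dyadic_adj m i (prev_node i)" "dyadic_adj m i (next_node m i)"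
    by (auto simp: dyadic_adj_def dyadic_clique_def)
  with dyadic_adj_prev_next[of i m] assms False show ?thesis
    by (auto simp: dyadic_clique_def dyadic_adj_refl intro: dyadic_adj_sym)
qed

text \<open>One of the two nodes is odd and therefore steps by 1. With
  \<open>dyadic_adj_wrap\<close>, all edges of the cycle lie in the triangulation.\<close>

lemma dyadic_adj_Suc:
  assumes "Suc i < m"
  shows "dyadic_adj m i (Suc i)"
proof (cases "even i")
  case True
  then have "multiplicity 2 (Suc i) = 0" by (simp add: not_dvd_imp_multiplicity_0)
  then show ?thesis by (simp add: dyadic_adj_def dyadic_clique_def prev_node_def)
next
  case False
  then have "multiplicity 2 i = 0" by (simp add: not_dvd_imp_multiplicity_0)
  with False assms show ?thesis by (auto simp: dyadic_adj_def dyadic_clique_def next_node_def)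
qed

lemma dyadic_adj_wrap:
  assumes "m > 0"
  shows "dyadic_adj m (m - 1) 0"
proof (cases "m - 1 = 0")
  case False
  have "1 \<le> (2::nat) ^ multiplicity 2 (m - 1)" by simp
  then have "\<not> m - 1 + 2 ^ multiplicity 2 (m - 1) < m" by linarith
  with False show ?thesis by (simp add: dyadic_adj_def dyadic_clique_def next_node_def)
qed (simp add: dyadic_adj_refl)

text \<open>
  Cliques are translated so that \<^const>\<open>prev_node\<close> moves to \<open>0\<close>.  The wrapped clique of valuation \<open>v\<close> has
  as \<^const>\<open>prev_node\<close> the largest multiple of \<open>2^(v + 1)\<close> below \<open>m\<close>, so its node \<open>0\<close> moves to
  \<open>(m - 1) mod 2^(v + 1) + 1\<close>.
\<close>

definition dyadic_differences :: "nat \<Rightarrow> nat \<Rightarrow> nat set" where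
  "dyadic_differences K m = insert 0 ((\<lambda>v. 2 ^ v) ` {..K} \<union> (\<lambda>v. (m - 1) mod 2 ^ Suc v + 1) ` {..<K})"

text \<open>The three parts contribute at most 1, \<open>K + 1\<close> and \<open>K\<close>
  elements.\<close>

lemma card_dyadic_differences: "card (dyadic_differences K m) \<le> 2 * K + 2"
proof -
  have "card ((\<lambda>v. 2 ^ v :: nat) ` {..K}) \<le> card {..K}"
    "card ((\<lambda>v. (m - 1) mod 2 ^ Suc v + 1) ` {..<K}) \<le> card {..<K}"
    by (rule card_image_le; simp)+
  then show ?thesis
    unfolding dyadic_differences_def
    by (intro order_trans[OF card_insert_le_m1] order_trans[OF card_Un_le]) auto
qed

lemma dyadic_clique_differences:
  assumes "i < m" "2 ^ K < m" "m \<le> 2 ^ Suc K" "j \<in> dyadic_clique m i"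
  shows "(int j - int (prev_node i)) mod int m \<in> int ` dyadic_differences K m"
proof (cases "i = 0")
  case True
  then show ?thesis
    using assms by (simp add: dyadic_clique_def prev_node_def dyadic_differences_def)
next
  case False
  define v where "v = multiplicity 2 i"
  obtain u where u: "i = 2 ^ v * (2 * u + 1)"
    using two_adic_decomposition False unfolding v_def by blast
  have prev: "prev_node i = 2 ^ Suc v * u"
    unfolding prev_node_def v_def[symmetric] by (subst u) simp
  have i: "i = prev_node i + 2 ^ v"
    unfolding prev by (subst u) (simp add: algebra_simps)
  have i': "int i = int (prev_node i) + int (2 ^ v)"
    using arg_cong[OF i, of int] by (simp only: of_nat_add)
  have small: "w \<le> K" if "2 ^ w < m" for w
  proof -
    have "(2::nat) ^ w < 2 ^ Suc K" using that assms(3) by linarith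
    then have "w < Suc K" by (subst (asm) power_strict_increasing_iff) auto
    then show ?thesis by simp
  qed
  have "j = i \<or> j = prev_node i \<or> j = next_node m i"
    using assms(4) False by (simp add: dyadic_clique_def)
  then consider "j = i" | "j = prev_node i" | "j = i + 2 ^ v" "i + 2 ^ v < m"
    | "j = 0" "m \<le> i + 2 ^ v"
    by (auto simp: next_node_def v_def split: if_splits)
  then show ?thesis
  proof cases
    case 1
    have "2 ^ v < m" using i assms(1) by linarith
    moreover have "int j - int (prev_node i) = int (2 ^ v)" using i' 1 by linarith
    ultimately show ?thesis using small[of v]
      by (auto simp: dyadic_differences_def simp flip: zmod_int)
  next
    case 2
    then show ?thesis by (simp add: dyadic_differences_def)
  next
    case 3
    have "2 ^ Suc v < m" using i 3 unfolding power_Suc by linarith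
    moreover have "int j - int (prev_node i) = int (2 ^ Suc v)" using i' 3 by simp
    ultimately show ?thesis using small[of "Suc v"]
      by (auto simp: dyadic_differences_def simp flip: zmod_int power_Suc)
  next
    case 4
    show ?thesis
    proof (cases "u = 0")
      case True
      then show ?thesis using 4 by (simp add: prev dyadic_differences_def)
    next
      case u0: False
      \<comment> \<open>A positive \<open>prev_node i\<close> is at least \<open>2^(v + 1)\<close>,
        whence \<open>v < K\<close>: only \<open>K\<close> wrapped differences have to be
        listed.\<close>
      then have "2 ^ Suc v * 1 \<le> 2 ^ Suc v * u" by (intro mult_le_mono2) simp
      then have "2 ^ Suc v < m" using i prev assms(1) by linarith
      then have v: "v < K" using small[of "Suc v"] by simp
      \<comment> \<open>\<open>m - 1\<close> lies in the interval of length \<open>2^(v + 1)\<close>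
        starting at \<open>prev_node i\<close>. Using \<open>m - 1\<close> covers the case
        \<open>m - prev_node i = 2^(v + 1)\<close>, where \<open>m\<close> would leave remainder
        0.\<close>
      have r: "m - 1 = (m - 1 - prev_node i) + 2 ^ Suc v * u" "m - 1 - prev_node i < 2 ^ Suc v"
        using i assms(1) 4 unfolding prev power_Suc by linarith+
      have "(m - 1) mod 2 ^ Suc v = (m - 1 - prev_node i) mod 2 ^ Suc v"
        using arg_cong[OF r(1), of "\<lambda>x. x mod 2 ^ Suc v"] by (simp only: mod_mult_self2)
      also have "\<dots> = m - 1 - prev_node i"
        using r(2) by (rule mod_less)
      finally have "(m - 1) mod 2 ^ Suc v = m - 1 - prev_node i" .
      then have e: "(m - 1) mod 2 ^ Suc v + 1 = m - prev_node i"
        using i assms(1) by linarith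
      have "0 < prev_node i" using u0 by (simp add: prev)
      then have "(int j - int (prev_node i)) mod int m = int (m - prev_node i)"
        using 4 i assms(1) by (simp add: zmod_zminus1_eq_if of_nat_diff)
      then show ?thesis
        unfolding e[symmetric] dyadic_differences_def using v by blast
    qed
  qed
qed

subsection \<open>Circulant matrices and sum-of-squares certificates\<close>

text \<open>By orthogonality the coefficient at \<open>l\<close> collects only those
  \<open>c k\<close> with \<open>e k\<close> congruent to \<open>l\<close>. Arbitrary integers
  \<open>e k\<close> accommodate translated frequencies.\<close>

lemma supported_on_combination:
  assumes "N > 0"
    and "\<And>k. k \<in> V \<Longrightarrow> c k \<noteq> 0 \<Longrightarrow> e k mod int N \<in> T"
  shows "supported_on N T (\<lambda>x. \<Sum>k\<in>V. c k * character N (e k) x)"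
  unfolding supported_on_def
proof
  fix l assume l: "l \<in> ZN N - T"
  have "(\<Sum>x\<in>ZN N. (\<Sum>k\<in>V. c k * character N (e k) x) * character N (- l) x)
     = (\<Sum>x\<in>ZN N. \<Sum>k\<in>V. c k * character N (e k - l) x)"
    by (simp add: sum_distrib_right mult.assoc character_mult)
  also have "\<dots> = (\<Sum>k\<in>V. c k * (\<Sum>x\<in>ZN N. character N (e k - l) x))"
    by (subst sum.swap) (simp add: sum_distrib_left)
  also have "\<dots> = 0"
  proof (intro sum.neutral ballI)
    fix k assume "k \<in> V"
    show "c k * (\<Sum>x\<in>ZN N. character N (e k - l) x) = 0"
    proof (cases "c k = 0")
      case False
      with assms(2) \<open>k \<in> V\<close> have "e k mod int N \<in> T" by blast
      moreover have "l mod int N = l" using l by (simp add: ZN_eq)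
      ultimately have "\<not> int N dvd e k - l" using l by (auto simp flip: mod_eq_dvd_iff)
      then show ?thesis using assms(1) by (simp add: character_orthogonal)
    qed simp
  qed
  finally show "fourier_coeff N (\<lambda>x. \<Sum>k\<in>V. c k * character N (e k) x) l = 0"
    using l assms(1) by (simp add: fourier_coeff_eq)
qed

lemma cnj_character: "cnj (character N k x) = character N (- k) x"
  by (simp add: character_def exp_cnj)

lemma norm_character [simp]: "cmod (character N k x) = 1"
  by (simp add: character_def)

lemma character_mod:
  assumes "N > 0"
  shows "character N (k mod int N) x = character N k x"
proof -
  have "character N (int N * q) x = 1" for q
  proof -
    have "character N (int N * q) x = exp (2 * of_real pi * \<i> * of_int (q * x))"
      using assms by (simp add: character_def mult_ac)
    also have "\<dots> = 1"
      by (subst exp_eq_1) (auto intro!: exI[of _ "q * x"])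
    finally show ?thesis .
  qed
  then show ?thesis
    using character_mult[of N "int N * (k div int N)" x "k mod int N"] by simp
qed

section \<open>The circulant matrix of a function and its Hermitian form\<close>

definition circulant :: "nat \<Rightarrow> (int \<Rightarrow> real) \<Rightarrow> int \<Rightarrow> int \<Rightarrow> complex" where
  "circulant N f k l = (\<Sum>x\<in>ZN N. of_real (f x) * character N (l - k) x) / of_nat N"

lemma circulant_fourier_coeff:
  assumes "N > 0"
  shows "circulant N f k l = fourier_coeff N (\<lambda>x. of_real (f x)) ((k - l) mod int N)"
proof -
  have "(k - l) mod int N \<in> ZN N" using assms by (simp add: ZN_eq)
  moreover have "character N (- ((k - l) mod int N)) x = character N (l - k) x" for x
    using character_mod[OF assms, of "k - l" x] cnj_character[of N "(k - l) mod int N" x]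
      cnj_character[of N "k - l" x] by simp
  ultimately show ?thesis
    by (simp add: circulant_def fourier_coeff_eq[OF assms])
qed

lemma circulant_cnj: "circulant N f l k = cnj (circulant N f k l)"
  by (simp add: circulant_def cnj_character)

text \<open>The matrix is an average of rank-one matrices of characters with weights
  \<open>f x\<close>, hence positive semidefinite for nonnegative \<open>f\<close>.\<close>

lemma hermitian_form_circulant:
  "hermitian_form V (circulant N f) z
     = of_real ((\<Sum>x\<in>ZN N. f x * (cmod (\<Sum>k\<in>V. z k * character N (- k) x))\<^sup>2) / of_nat N)"
proof -
  have "of_real ((\<Sum>x\<in>ZN N. f x * (cmod (\<Sum>k\<in>V. z k * character N (- k) x))\<^sup>2) / of_nat N)
     = (\<Sum>x\<in>ZN N. of_real (f x) / of_nat N *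
         hermitian_form V (\<lambda>k l. character N (- k) x * cnj (character N (- l) x)) z)"
    by (simp add: hermitian_form_rank_one sum_divide_distrib mult_ac)
  also have "\<dots> = (\<Sum>x\<in>ZN N. \<Sum>k\<in>V. \<Sum>l\<in>V.
      of_real (f x) * character N (l - k) x / of_nat N * z k * cnj (z l))"
    by (simp add: hermitian_form_def sum_distrib_left cnj_character character_mult mult_ac)
  also have "\<dots> = (\<Sum>k\<in>V. \<Sum>x\<in>ZN N. \<Sum>l\<in>V.
      of_real (f x) * character N (l - k) x / of_nat N * z k * cnj (z l))"
    by (rule sum.swap)
  also have "\<dots> = (\<Sum>k\<in>V. \<Sum>l\<in>V. \<Sum>x\<in>ZN N.
      of_real (f x) * character N (l - k) x / of_nat N * z k * cnj (z l))"
    by (intro sum.cong refl sum.swap)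
  also have "\<dots> = hermitian_form V (circulant N f) z"
    by (simp add: hermitian_form_def circulant_def sum_distrib_right sum_divide_distrib)
  finally show ?thesis ..
qed

text \<open>By orthogonality only the term \<open>y = x\<close> of the average survives, with factor
  \<open>N^2 / N\<close>.\<close>

lemma hermitian_form_circulant_character:
  assumes "N > 0" "x \<in> ZN N"
  shows "hermitian_form (ZN N) (circulant N f) (\<lambda>k. character N k x) = of_real (real N * f x)"
proof -
  have "(\<Sum>k\<in>ZN N. character N k x * character N (- k) y) = (if y = x then of_nat N else 0)"
    if "y \<in> ZN N" for y
  proof -
    have "(\<Sum>k\<in>ZN N. character N k x * character N (- k) y) = (\<Sum>k\<in>ZN N. character N (x - y) k)"
      using character_mult[of N x _ "- y"]
      by (simp add: character_uminus[of N _ y] character_commute[of N _ x])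
    also have "\<dots> = (if y = x then of_nat N else 0)"
    proof -
      have "int N dvd x - y \<longleftrightarrow> y = x"
        using assms(2) that unfolding ZN_eq by (auto simp flip: mod_eq_dvd_iff)
      then show ?thesis by (simp only: character_orthogonal[OF assms(1)])
    qed
    finally show ?thesis .
  qed
  then have "(\<Sum>y\<in>ZN N. f y * (cmod (\<Sum>k\<in>ZN N. character N k x * character N (- k) y))\<^sup>2)
      = (\<Sum>y\<in>ZN N. if y = x then f y * (real N)\<^sup>2 else 0)"
    by (intro sum.cong refl) simp
  also have "\<dots> = f x * (real N)\<^sup>2"
    using assms(2) by (simp add: ZN_eq)
  finally show ?thesis
    using assms(1) unfolding hermitian_form_circulant by (simp add: power2_eq_square)
qed

lemma chordal_sos_certificate:
  fixes r :: "int \<Rightarrow> nat" and s :: "int \<Rightarrow> int"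
  assumes "N > 0" "\<And>x. x \<in> ZN N \<Longrightarrow> f x \<ge> 0"
    and supp: "\<And>k l. k \<in> ZN N \<Longrightarrow> l \<in> ZN N \<Longrightarrow> circulant N f k l \<noteq> 0 \<Longrightarrow> adj k l"
    and chordal: "\<And>v k l. v \<in> ZN N \<Longrightarrow> k \<in> ZN N \<Longrightarrow> l \<in> ZN N \<Longrightarrow> r v \<le> r k \<Longrightarrow> r v \<le> r l \<Longrightarrow>
           adj v k \<Longrightarrow> adj v l \<Longrightarrow> adj k l"
    and T: "\<And>v k. v \<in> ZN N \<Longrightarrow> k \<in> ZN N \<Longrightarrow> r v \<le> r k \<Longrightarrow> adj v k \<Longrightarrow> (k - s v) mod int N \<in> T"
  shows "has_sos_certificate N T f"
proof -
  have "\<exists>g. (\<forall>v\<in>ZN N. \<forall>k\<in>ZN N. g v k \<noteq> 0 \<longrightarrow> adj v k \<and> r v \<le> r k) \<and>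
     (\<forall>z. hermitian_form (ZN N) (circulant N f) z
        = of_real (\<Sum>v\<in>ZN N. (cmod (\<Sum>k\<in>ZN N. g v k * z k))\<^sup>2))"
  proof (rule chordal_sos_decomposition)
    show "0 \<le> Re (hermitian_form (ZN N) (circulant N f) z)" for z
      unfolding hermitian_form_circulant using assms(2)
      by (auto intro!: divide_nonneg_nonneg sum_nonneg)
    show "finite (ZN N)" by (simp add: ZN_eq)
    show "circulant N f l k = cnj (circulant N f k l)" for k l by (rule circulant_cnj)
  qed (fact supp chordal)+
  then obtain g where g: "\<And>v k. v \<in> ZN N \<Longrightarrow> k \<in> ZN N \<Longrightarrow> g v k \<noteq> 0 \<Longrightarrow> adj v k \<and> r v \<le> r k"
    and sos: "\<And>z. hermitian_form (ZN N) (circulant N f) z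
       = of_real (\<Sum>v\<in>ZN N. (cmod (\<Sum>k\<in>ZN N. g v k * z k))\<^sup>2)"
    by blast
  \<comment> \<open>The shift by \<open>- s v\<close> factors out a character of modulus 1;
    \<open>1 / sqrt N\<close> compensates for the form being \<open>N f(x)\<close> at the
    characters.\<close>
  define h where "h v x = (\<Sum>k\<in>ZN N. g v k / of_real (sqrt (real N)) * character N (k - s v) x)" for v x
  have cmod_h: "(cmod (h v x))\<^sup>2 = (cmod (\<Sum>k\<in>ZN N. g v k * character N k x))\<^sup>2 / real N" for v x
  proof -
    have "h v x = character N (- s v) x * (\<Sum>k\<in>ZN N. g v k * character N k x) / of_real (sqrt (real N))"
      using character_mult[of N _ x "- s v"]
      by (simp add: h_def sum_distrib_left sum_divide_distrib mult_ac)
    then show ?thesis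
      by (simp add: norm_mult norm_divide power_divide)
  qed
  have "supported_on N T (h v)" if "v \<in> ZN N" for v
    unfolding h_def using g[OF that] T[OF that] assms(1)
    by (intro supported_on_combination) auto
  moreover have "f x = (\<Sum>v\<in>ZN N. (cmod (h v x))\<^sup>2)" if "x \<in> ZN N" for x
  proof -
    have "complex_of_real (real N * f x)
        = of_real (\<Sum>v\<in>ZN N. (cmod (\<Sum>k\<in>ZN N. g v k * character N k x))\<^sup>2)"
      using hermitian_form_circulant_character[OF assms(1) that, of f]
        sos[of "\<lambda>k. character N k x"] by metis
    then have "real N * f x = (\<Sum>v\<in>ZN N. (cmod (\<Sum>k\<in>ZN N. g v k * character N k x))\<^sup>2)"
      by (simp only: of_real_eq_iff)
    then show ?thesis
      using assms(1) unfolding cmod_h sum_divide_distrib[symmetric] by (simp add: field_simps)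
  qed
  ultimately show ?thesis
    unfolding has_sos_certificate_def sum_ZN
    by (intro exI[of _ N] exI[of _ "\<lambda>j. h (int j)"]) (auto simp: ZN_eq)
qed

subsection \<open>Blow-up of the cycle by blocks\<close>

definition block :: "nat \<Rightarrow> int \<Rightarrow> nat" where
  "block d k = nat (k div int d)"

lemma block_eq_div_less:
  assumes "d > 0" "k \<in> ZN (d * m)"
  shows "int (block d k) = k div int d" "block d k < m"
proof -
  have k: "0 \<le> k" "k < int d * int m" using assms(2) unfolding ZN_eq by auto
  then show *: "int (block d k) = k div int d"
    using assms(1) by (simp add: block_def pos_imp_zdiv_nonneg_iff)
  have "k div int d < int m"
  proof (rule ccontr)
    assume "\<not> k div int d < int m"
    then have "int d * int m \<le> int d * (k div int d)" by (intro mult_left_mono) auto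
    also have "\<dots> \<le> k" using assms(1) pos_mod_sign[of "int d" k] mult_div_mod_eq[of "int d" k] by linarith
    finally show False using k by simp
  qed
  with * show "block d k < m" by linarith
qed

text \<open>A nonzero entry forces \<open>k - l\<close> to be within \<open>d\<close> of 0 modulo
  \<open>N\<close>. The blocks are then equal or consecutive, or, across the wrap, the last and the
  first.\<close>

lemma degree_at_most_block_adj:
  assumes "d > 0" "m > 0" and N: "N = d * m"
    and deg: "degree_at_most N d (\<lambda>x. complex_of_real (f x))"
    and k: "k \<in> ZN N" and l: "l \<in> ZN N" and nz: "circulant N f k l \<noteq> 0"
  shows "dyadic_adj m (block d k) (block d l)"
proof -
  have main: "dyadic_adj m (block d k) (block d l)"
    if k: "k \<in> ZN N" and l: "l \<in> ZN N" and c: "\<bar>k - l\<bar> \<le> int d \<or> k - l \<ge> int N - int d"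
      and le: "l \<le> k" for k l
  proof -
    have b: "int (block d k) = k div int d" "int (block d l) = l div int d" and km: "block d k < m"
      using block_eq_div_less[OF assms(1)] k l unfolding N by blast+
    from c show ?thesis
    proof
      assume "\<bar>k - l\<bar> \<le> int d"
      then have "k \<le> l + int d" by linarith
      then have "k div int d \<le> (l + int d) div int d" using assms(1) by (intro zdiv_mono1) auto
      then have "k div int d \<le> l div int d + 1" using assms(1) by simp
      moreover have "l div int d \<le> k div int d" using le assms(1) by (intro zdiv_mono1) auto
      ultimately have "block d k = block d l \<or> block d k = Suc (block d l)" using b by linarith
      then show ?thesis
        using km dyadic_adj_Suc dyadic_adj_sym dyadic_adj_refl by metis
    next
      assume h: "k - l \<ge> int N - int d"
      \<comment> \<open>\<open>l >= 0\<close> pushes \<open>k\<close> into the last block, and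
        \<open>k < N\<close> pushes \<open>l\<close> into the first.\<close>
      have "int d * (int m - 1) \<le> k" using h l unfolding ZN_eq by (simp add: N algebra_simps)
      then have "int d * (int m - 1) div int d \<le> k div int d" using assms(1)
        by (intro zdiv_mono1) auto
      then have "int m - 1 \<le> k div int d" using assms(1) by simp
      with km b have "block d k = m - 1" by linarith
      moreover have "l < int d" using h k by (simp add: ZN_eq)
      then have "block d l = 0" using l by (simp add: block_def ZN_eq)
      ultimately show ?thesis using dyadic_adj_wrap assms(2) by simp
    qed
  qed
  have "N > 0" using assms by simp
  have "(k - l) mod int N \<in> ZN N" using \<open>N > 0\<close> by (simp add: ZN_eq)
  with nz deg have "(k - l) mod int N \<in> (\<lambda>k. k mod int N) ` {- int d..int d}"
    unfolding circulant_fourier_coeff[OF \<open>N > 0\<close>] degree_at_most_def supported_on_def by blast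
  then obtain t where t: "- int d \<le> t" "t \<le> int d" "(k - l) mod int N = t mod int N" by auto
  then obtain q where q: "k - l = t + int N * q"
    by (metis mod_eqE add_diff_cancel_left' diff_add_cancel mod_eq_dvd_iff dvdE)
  have "\<bar>k - l\<bar> < int N" using k l by (auto simp: ZN_eq)
  have "\<bar>k - l\<bar> \<le> int d \<or> \<bar>k - l\<bar> \<ge> int N - int d"
  proof (cases "q = 0")
    case False
    then have "int N * 1 \<le> int N * \<bar>q\<bar>" by (intro mult_left_mono) auto
    then have "int N \<le> \<bar>int N * q\<bar>" by (simp add: abs_mult)
    then show ?thesis using q t by linarith
  qed (use q t in auto)
  then show ?thesis
    using main[OF k l] main[OF l k] dyadic_adj_sym by (cases "l \<le> k") force+
qed

section \<open>Size of the support and assembly of the certificate\<close>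

text \<open>Amounts to \<open>2^(2K + 2) <= m^3\<close>. For \<open>K >= 2\<close> use
  \<open>2K + 2 <= 3K\<close>; for \<open>K = 0\<close> and \<open>K = 1\<close> the strict bound
  \<open>m >= 2^K + 1\<close> gives 4 <= 8 and 16 <= 27.\<close>

lemma dyadic_bound:
  assumes "2 ^ K < m"
  shows "2 * real K + 2 \<le> 3 * log 2 (real m)"
proof -
  have "(2::nat) ^ (2 * K + 2) \<le> (2 ^ K + 1) ^ 3"
  proof (cases "K \<le> 1")
    case True
    then have "K = 0 \<or> K = 1" by auto
    then show ?thesis by (auto simp: eval_nat_numeral)
  next
    case False
    then have "(2::nat) ^ (2 * K + 2) \<le> 2 ^ (K * 3)" by (intro power_increasing) auto
    also have "\<dots> \<le> (2 ^ K + 1) ^ 3" unfolding power_mult by (intro power_mono) auto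
    finally show ?thesis .
  qed
  also have "\<dots> \<le> m ^ 3" using assms by (intro power_mono) auto
  finally have "real (2 ^ (2 * K + 2)) \<le> real (m ^ 3)" by (simp only: of_nat_le_iff)
  then have "log 2 (2 ^ (2 * K + 2)) \<le> log 2 (real m ^ 3)"
    using assms by (subst log_le_cancel_iff) auto
  moreover have "log 2 (2 ^ (2 * K + 2)) = real (2 * K + 2)"
    by (rule log_pow_cancel) auto
  moreover have "log 2 (real m ^ 3) = 3 * log 2 (real m)"
    using assms by (simp add: log_nat_power)
  ultimately show ?thesis by simp
qed

theorem theorem3:
  fixes N d :: nat
  assumes "N > 0" and "d > 0" and "d dvd N" and "d < N"
  shows "\<exists>T\<subseteq>ZN N.
           real (card T) \<le> 3 * real d * log 2 (real N / real d) \<and>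
           (\<forall>f :: int \<Rightarrow> real.
              degree_at_most N d (\<lambda>x. complex_of_real (f x)) \<and> (\<forall>x\<in>ZN N. f x \<ge> 0) \<longrightarrow>
              has_sos_certificate N T f)"
proof -
  obtain m where N: "N = d * m" using assms(3) by blast
  \<comment> \<open>\<open>d < N\<close> enters here: an exponent \<open>K\<close> with
    \<open>2^K < m <= 2^(K + 1)\<close> exists only for \<open>m > 1\<close>.\<close>
  then have "m > 1" using assms by (cases m) auto
  then have "\<exists>K. 2 ^ K < m \<and> m \<le> 2 ^ Suc K"
    using ex_power_ivl2[of 2 m] by auto
  then obtain K where K: "2 ^ K < m" "m \<le> 2 ^ Suc K" by blast
  define D where "D = dyadic_differences K m"
  \<comment> \<open>The union of the blocks indexed by \<open>D\<close>, fixed before any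
    \<open>f\<close>; it has at most \<open>d (2K + 2)\<close> elements.\<close>
  define T where "T = {x \<in> ZN N. x div int d \<in> int ` D}"
  have "finite D" by (simp add: D_def dyadic_differences_def)
  have "T \<subseteq> (\<Union>b\<in>D. {int d * int b..<int d * int b + int d})"
  proof
    fix x assume "x \<in> T"
    then obtain b where "b \<in> D" "x div int d = int b" by (auto simp: T_def)
    moreover have "x = int d * (x div int d) + x mod int d" by simp
    moreover have "0 \<le> x mod int d" "x mod int d < int d" using assms(2) by auto
    ultimately show "x \<in> (\<Union>b\<in>D. {int d * int b..<int d * int b + int d})"
      by (intro UN_I[of b]) auto
  qed
  then have "card T \<le> card (\<Union>b\<in>D. {int d * int b..<int d * int b + int d})"
    using \<open>finite D\<close> by (intro card_mono) auto
  also have "\<dots> \<le> (\<Sum>b\<in>D. card {int d * int b..<int d * int b + int d})"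
    using \<open>finite D\<close> by (rule card_UN_le)
  also have "\<dots> = card D * d" by simp
  also have "\<dots> \<le> (2 * K + 2) * d"
    unfolding D_def by (intro mult_le_mono1 card_dyadic_differences)
  finally have "real (card T) \<le> real ((2 * K + 2) * d)" by (simp only: of_nat_le_iff)
  also have "\<dots> = real d * (2 * real K + 2)" by (simp add: algebra_simps)
  also have "\<dots> \<le> real d * (3 * log 2 (real m))"
    by (intro mult_left_mono dyadic_bound K) auto
  also have "real m = real N / real d" using assms(2) by (simp add: N)
  finally have "real (card T) \<le> 3 * real d * log 2 (real N / real d)" by simp
  moreover have "has_sos_certificate N T f"
    if deg: "degree_at_most N d (\<lambda>x. complex_of_real (f x))" and pos: "\<forall>x\<in>ZN N. f x \<ge> 0" for f
  \<comment> \<open>Frequencies inherit adjacency and level from their blocks; the translation moves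
    the block of the previous node to block 0.\<close>
  proof (rule chordal_sos_certificate[where adj = "\<lambda>k l. dyadic_adj m (block d k) (block d l)"
        and r = "\<lambda>k. dyadic_level m (block d k)"
        and s = "\<lambda>k. int d * int (prev_node (block d k))"])
    have b: "int (block d k) = k div int d" "block d k < m" if "k \<in> ZN N" for k
      using block_eq_div_less[OF assms(2)] that unfolding N by blast+
    show "dyadic_adj m (block d k) (block d l)"
      if "k \<in> ZN N" "l \<in> ZN N" "circulant N f k l \<noteq> 0" for k l
      using that deg assms(2) \<open>m > 1\<close> by (intro degree_at_most_block_adj[OF _ _ N]) auto
    show "dyadic_adj m (block d k) (block d l)"
      if "v \<in> ZN N" "k \<in> ZN N" "l \<in> ZN N"
        "dyadic_level m (block d v) \<le> dyadic_level m (block d k)"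
        "dyadic_level m (block d v) \<le> dyadic_level m (block d l)"
        "dyadic_adj m (block d v) (block d k)" "dyadic_adj m (block d v) (block d l)" for v k l
      using that b by (meson dyadic_clique_adj dyadic_adj_level)
    show "(k - int d * int (prev_node (block d v))) mod int N \<in> T"
      if "v \<in> ZN N" "k \<in> ZN N" "dyadic_level m (block d v) \<le> dyadic_level m (block d k)"
        "dyadic_adj m (block d v) (block d k)" for v k
    proof -
      define a where "a = int (prev_node (block d v))"
      have "(int (block d k) - a) mod int m \<in> int ` D"
        unfolding a_def D_def using that b K
        by (intro dyadic_clique_differences dyadic_adj_level) auto
      \<comment> \<open>As \<open>N = d m\<close>, reducing modulo \<open>N\<close> and then taking
        the block is the same as taking the block and reducing modulo \<open>m\<close>.\<close>
      moreover have "(k - int d * a) mod int N div int d = (k - int d * a) div int d mod int m"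
        using assms(2) by (simp add: N zmod_zmult2_eq)
      moreover have "(k - int d * a) div int d = k div int d - a"
        using assms(2) div_mult_self2[of "int d" k "- a"] by simp
      ultimately show ?thesis
        using assms(1) b(1)[OF that(2)] by (simp add: T_def ZN_eq a_def)
    qed
  qed (use assms pos in auto)
  ultimately show ?thesis
    by (intro exI[of _ T]) (auto simp: T_def)
qed

end
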